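(* Suppose $X$ is an Asplund space and $Q$ is a nonempty weak$^{*}$ compact convex subset of $X^{*}$. If $(S,Q)$ is a nonexpansive and norm-distal dynamical system, where $Q$ carries the weak$^{*}$ topology, then there is a fixed point of $S$ in $Q$, i.e. a point $x\in Q$ with $sx=x$ for every $s\in S$.
   Context: A Banach space $X$ is Asplund if every continuous convex function on any open convex subset $U$ of $X$ is Fréchet differentiable on a dense $G_\delta$-subset of $U$. A dynamical system $(S,Q)$ consists of a semigroup $S$, a topological space $Q$ and a semigroup action $S\times Q\to Q$, $(s,x)\mapsto sx$ (so $(st)x=s(tx)$), such that for each $s\in S$ the map $Q\ni x\mapsto sx\in Q$ is continuous in the topology of $Q$ (here the weak$^{*}$ topology $\sigma(X^{*},X)$). It is nonexpansive if $\|sx-sy\|\le\|x-y\|$ for all $s\in S$, $x,y\in Q$, and norm-distal if for every pair of distinct $x,y\in Q$, $0$ does not belong to the norm closure of $\{sx-sy:s\in S\}$. *)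

theory Defs
  imports "HOL-Analysis.Analysis"
begin

definition asplund_space :: "'a::banach itself \<Rightarrow> bool" where
  "asplund_space _ \<longleftrightarrow>
     (\<forall>(U :: 'a set) (f :: 'a \<Rightarrow> real).
        open U \<longrightarrow> convex U \<longrightarrow> convex_on U f \<longrightarrow> continuous_on U f \<longrightarrow>
        (\<exists>G. gdelta_in (top_of_set U) G \<and> U \<subseteq> closure G \<and>
             (\<forall>x\<in>G. f differentiable (at x))))"

text \<open>For real-valued operators, the strong operator topology is the topology of pointwise
  convergence on the dual space, that is, the topology \<open>\<sigma>(X\<^sup>*, X)\<close>.\<close>

abbreviation weak_star_topology :: "('a::real_normed_vector \<Rightarrow>\<^sub>L real) topology" where
  "weak_star_topology \<equiv> strong_operator_topology"

text \<open>The phase space is \<^term>\<open>topspace T\<close>; \<^const>\<open>continuous_map\<close> includes that each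
  \<^term>\<open>act s\<close> maps it into itself. Values of \<^term>\<open>act s\<close> elsewhere are irrelevant.\<close>

definition dynamical_system ::
    "'b topology \<Rightarrow> ('s::semigroup_mult \<Rightarrow> 'b \<Rightarrow> 'b) \<Rightarrow> bool" where
  "dynamical_system T act \<longleftrightarrow>
     (\<forall>s. continuous_map T T (act s)) \<and>
     (\<forall>s t. \<forall>x\<in>topspace T. act (s * t) x = act s (act t x))"

definition nonexpansive_action :: "'b::real_normed_vector set \<Rightarrow> ('s \<Rightarrow> 'b \<Rightarrow> 'b) \<Rightarrow> bool" where
  "nonexpansive_action Q act \<longleftrightarrow>
     (\<forall>s. \<forall>x\<in>Q. \<forall>y\<in>Q. norm (act s x - act s y) \<le> norm (x - y))"

definition norm_distal :: "'b::real_normed_vector set \<Rightarrow> ('s \<Rightarrow> 'b \<Rightarrow> 'b) \<Rightarrow> bool" where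
  "norm_distal Q act \<longleftrightarrow>
     (\<forall>x\<in>Q. \<forall>y\<in>Q. x \<noteq> y \<longrightarrow> 0 \<notin> closure (range (\<lambda>s. act s x - act s y)))"

end

theory Submission
  imports Defs
begin

text \<open>
  Choose a minimal nonempty weak\<open>\<^sup>*\<close> closed convex invariant subset \<open>C\<close> of \<open>Q\<close> and inside it a
  minimal nonempty weak\<open>\<^sup>*\<close> closed invariant subset \<open>K\<close>, not required to be convex. The claim is
  that \<open>K\<close> is a single point, which is then fixed.

  The Asplund property enters through the support functional of \<open>K\<close>: near a point of Frechet
  differentiability of this continuous convex function, the almost maximizing functionals in \<open>K\<close> are
  close in norm, so \<open>K\<close> has nonempty relatively weak\<open>\<^sup>*\<close> open subsets of arbitrarily small norm
  diameter (\<open>asplund_small_weak_star_slice\<close>). By minimality every orbit in \<open>K\<close> visits each such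
  subset. Hence a pair of points of \<open>K\<close> that is brought together in the weak\<open>\<^sup>*\<close> topology is also
  brought together in norm, and norm-distality makes \<open>K\<close> distal for the weak\<open>\<^sup>*\<close> topology.

  Ellis' theorem now applies: the pointwise closure of the acting semigroup consists of invertible
  maps, because in a distal system the only idempotent is the identity. So every \<open>s\<close> maps \<open>K\<close> onto
  itself, and the weak\<open>\<^sup>*\<close> limits of semigroup elements that undo \<open>s\<close> show, by weak\<open>\<^sup>*\<close> lower
  semicontinuity of the norm, that \<open>s\<close> does not shrink distances in \<open>K\<close>
  (\<open>distal_system_surjective\<close>, \<open>distal_system_recurrent\<close>).

  If \<open>d\<close>, the norm diameter of \<open>K\<close>, were positive, take a slice \<open>U\<close> of diameter at most \<open>d / 2\<close>. Its
  preimages cover \<open>K\<close>; finitely many suffice, and each again has diameter at most \<open>d / 2\<close>. Averaging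
  one point from each gives \<open>u \<in> C\<close> and \<open>r < d\<close> with \<open>K\<close> inside the ball of radius \<open>r\<close> about \<open>u\<close>
  (\<open>average_closer_than_diameter\<close>). The set of all such centres in \<open>C\<close> is weak\<open>\<^sup>*\<close> closed and
  convex, and invariant because the action is nonexpansive and maps \<open>K\<close> onto itself; so it equals
  \<open>C\<close> and contains \<open>K\<close>, which forces \<open>d \<le> r\<close>.
\<close>

section \<open>Minimal closed sets\<close>

text \<open>
  Zorn's lemma, with compactness keeping the intersection of a chain nonempty. The property \<open>P\<close> is
  a parameter because the same argument serves convex invariant sets, invariant sets and
  subsemigroups.
\<close>
lemma minimal_closed_subset:
  assumes T: "compact_space T" and C: "closedin T C" "C \<noteq> {}" "P C"
    and Int: "\<And>\<C>. \<C> \<noteq> {} \<Longrightarrow> (\<And>A. A \<in> \<C> \<Longrightarrow> P A) \<Longrightarrow> P (\<Inter>\<C>)"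
  obtains M where "M \<subseteq> C" "closedin T M" "M \<noteq> {}" "P M"
    "\<And>N. N \<subseteq> M \<Longrightarrow> closedin T N \<Longrightarrow> N \<noteq> {} \<Longrightarrow> P N \<Longrightarrow> N = M"
proof -
  \<comment> \<open>Complements turn the search for a minimal set into one for a maximal set.\<close>
  define \<D> where "\<D> = {A. A \<subseteq> C \<and> closedin T A \<and> A \<noteq> {} \<and> P A}"
  have "\<exists>M\<in>uminus ` \<D>. \<forall>X\<in>uminus ` \<D>. M \<subseteq> X \<longrightarrow> X = M"
  proof (rule subset_Zorn_nonempty)
    show "uminus ` \<D> \<noteq> {}" using C by (auto simp: \<D>_def)
    fix \<C> assume ne: "\<C> \<noteq> {}" and ch: "subset.chain (uminus ` \<D>) \<C>"
    define \<E> where "\<E> = uminus ` \<C>"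
    have \<E>D: "\<E> \<subseteq> \<D>" using ch by (auto simp: \<E>_def subset.chain_def)
    have \<E>0: "\<E> \<noteq> {}" using ne by (simp add: \<E>_def)
    have lin: "A \<subseteq> B \<or> B \<subseteq> A" if "A \<in> \<E>" "B \<in> \<E>" for A B
      using ch that unfolding subset_chain_def \<E>_def by blast
    have fin: "\<Inter>\<F> \<in> \<F>" if "finite \<F>" "\<F> \<noteq> {}" "\<F> \<subseteq> \<E>" for \<F>
      using that
    proof (induction rule: finite_ne_induct)
      case (insert A \<F>)
      then have "\<Inter>\<F> \<in> \<F>" by simp
      moreover have "A \<subseteq> \<Inter>\<F> \<or> \<Inter>\<F> \<subseteq> A" using lin[of A "\<Inter>\<F>"] insert.prems calculation by auto
      ultimately show ?case by (auto simp: Int_absorb1 Int_absorb2)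
    qed simp
    have "\<Inter>\<E> \<noteq> {}"
    proof -
      have "\<forall>A\<in>\<E>. closedin T A" using \<E>D by (auto simp: \<D>_def)
      moreover have "\<Inter>\<F> \<noteq> {}" if "finite \<F>" "\<F> \<subseteq> \<E>" for \<F>
      proof (cases "\<F> = {}")
        case False
        then have "\<Inter>\<F> \<in> \<D>" using fin that \<E>D by blast
        then show ?thesis by (simp add: \<D>_def)
      qed simp
      ultimately show ?thesis using T compact_space_fip[of T] by simp
    qed
    moreover have "\<Inter>\<E> \<subseteq> C" using \<E>D \<E>0 by (auto simp: \<D>_def)
    moreover have "closedin T (\<Inter>\<E>)" using \<E>D \<E>0 by (intro closedin_Inter) (auto simp: \<D>_def)
    moreover have "P (\<Inter>\<E>)" using \<E>D \<E>0 by (intro Int) (auto simp: \<D>_def)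
    ultimately have "\<Inter>\<E> \<in> \<D>" by (simp add: \<D>_def)
    moreover have "\<Union>\<C> = - \<Inter>\<E>" by (auto simp: \<E>_def)
    ultimately show "\<Union>\<C> \<in> uminus ` \<D>" by blast
  qed
  then obtain M where M: "M \<in> \<D>" "\<forall>N\<in>\<D>. - M \<subseteq> - N \<longrightarrow> - N = - M"
    unfolding bex_simps ball_simps by (elim bexE)
  show thesis
  proof
    show "M \<subseteq> C" "closedin T M" "M \<noteq> {}" "P M" using M(1) by (auto simp: \<D>_def)
    fix N assume "N \<subseteq> M" "closedin T N" "N \<noteq> {}" "P N"
    then show "N = M" using M by (auto simp: \<D>_def)
  qed
qed

text \<open>The closure of an orbit is closed and invariant, so by minimality it is all of \<open>K\<close>.\<close>
lemma orbit_meets_open_of_minimal: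
  assumes dyn: "dynamical_system T act" and K: "closedin T K" "\<And>s. act s ` K \<subseteq> K"
    and min: "\<And>N. N \<subseteq> K \<Longrightarrow> closedin T N \<Longrightarrow> N \<noteq> {} \<Longrightarrow> (\<And>s. act s ` N \<subseteq> N) \<Longrightarrow> N = K"
    and x: "x \<in> K" and U: "openin T U" "U \<inter> K \<noteq> {}"
  shows "\<exists>s. act s x \<in> U"
proof -
  let ?O = "range (\<lambda>s. act s x)"
  have xT: "x \<in> topspace T" using x K closedin_subset by blast
  have OK: "?O \<subseteq> K" using K x by blast
  have cl: "T closure_of ?O = K"
  proof (rule min)
    show "T closure_of ?O \<subseteq> K" using OK K by (simp add: closure_of_minimal)
    have "?O \<subseteq> T closure_of ?O"
      using OK K closedin_subset by (intro closure_of_subset) blast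
    then show "T closure_of ?O \<noteq> {}" by blast
    fix t
    have "act t ` (T closure_of ?O) \<subseteq> T closure_of (act t ` ?O)"
      using dyn by (intro continuous_map_image_closure_subset) (simp add: dynamical_system_def)
    also have "act t ` ?O \<subseteq> ?O"
    proof
      fix y assume "y \<in> act t ` ?O"
      then obtain s where "y = act t (act s x)" by blast
      then have "y = act (t * s) x" using dyn xT by (simp add: dynamical_system_def)
      then show "y \<in> ?O" by blast
    qed
    then have "T closure_of (act t ` ?O) \<subseteq> T closure_of ?O" by (rule closure_of_mono)
    finally show "act t ` (T closure_of ?O) \<subseteq> T closure_of ?O" .
  qed simp
  from U obtain y where "y \<in> U" "y \<in> T closure_of ?O" using cl by blast
  then show ?thesis using U by (auto simp: in_closure_of)
qed

section \<open>Idempotents and distal systems\<close>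

text \<open>
  The Ellis--Numakura lemma. In a minimal closed subsemigroup \<open>M\<close>, any \<open>e\<close> satisfies \<open>M e = M\<close>, so \<open>e\<close>
  has a left unit in \<open>M\<close>; the left units of \<open>e\<close> again form a closed subsemigroup, hence include \<open>e\<close>
  itself. Only right translations need to be continuous, which is all that composition of arbitrary
  maps offers in the topology of pointwise convergence.
\<close>
lemma compact_right_topological_semigroup_idempotent:
  assumes P: "compact_space P" "Hausdorff_space P"
    and A: "closedin P A" "A \<noteq> {}" "\<And>f g. f \<in> A \<Longrightarrow> g \<in> A \<Longrightarrow> m f g \<in> A"
    and assoc: "\<And>f g h. m (m f g) h = m f (m g h)"
    and right: "\<And>g. g \<in> A \<Longrightarrow> continuous_map P P (\<lambda>f. m f g)"
  shows "\<exists>e\<in>A. m e e = e"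
proof -
  obtain M where M: "M \<subseteq> A" "closedin P M" "M \<noteq> {}" "\<forall>f\<in>M. \<forall>g\<in>M. m f g \<in> M"
    and min: "\<And>N. N \<subseteq> M \<Longrightarrow> closedin P N \<Longrightarrow> N \<noteq> {} \<Longrightarrow> \<forall>f\<in>N. \<forall>g\<in>N. m f g \<in> N \<Longrightarrow> N = M"
  proof (rule minimal_closed_subset[OF P(1) A(1,2),
        where P = "\<lambda>B. \<forall>f\<in>B. \<forall>g\<in>B. m f g \<in> B"])
    show "\<forall>f\<in>A. \<forall>g\<in>A. m f g \<in> A" using A by blast
    show "\<forall>f\<in>\<Inter>\<C>. \<forall>g\<in>\<Inter>\<C>. m f g \<in> \<Inter>\<C>"
      if "\<And>B. B \<in> \<C> \<Longrightarrow> \<forall>f\<in>B. \<forall>g\<in>B. m f g \<in> B" for \<C>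
      using that by blast
  qed (rule that)
  obtain e where e: "e \<in> M" using M by blast
  have cont: "continuous_map P P (\<lambda>f. m f e)" using right e M by blast
  have "(\<lambda>f. m f e) ` M = M"
  proof (rule min)
    show "(\<lambda>f. m f e) ` M \<subseteq> M" using M e by blast
    have "compactin P ((\<lambda>f. m f e) ` M)"
      using cont P M by (intro image_compactin) (auto intro: closedin_compact_space)
    then show "closedin P ((\<lambda>f. m f e) ` M)"
      using P by (simp add: compactin_imp_closedin)
    show "(\<lambda>f. m f e) ` M \<noteq> {}" using e by blast
    show "\<forall>f\<in>(\<lambda>f. m f e) ` M. \<forall>g\<in>(\<lambda>f. m f e) ` M. m f g \<in> (\<lambda>f. m f e) ` M"
      using M e by (auto simp: assoc[symmetric])
  qed
  then obtain f where f: "f \<in> M" "m f e = e" using e by (metis imageE)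
  have eP: "e \<in> topspace P" using e M closedin_subset by blast
  have "{f \<in> M. m f e = e} = M"
  proof (rule min)
    have "closedin P {f \<in> topspace P. m f e \<in> {e}}"
      using cont P eP by (intro closedin_continuous_map_preimage) (auto simp: closedin_Hausdorff_singleton)
    moreover have "{f \<in> M. m f e = e} = M \<inter> {f \<in> topspace P. m f e \<in> {e}}"
      using M closedin_subset by blast
    ultimately show "closedin P {f \<in> M. m f e = e}" using M by auto
    show "{f \<in> M. m f e = e} \<noteq> {}" using f by blast
    show "\<forall>f\<in>{f \<in> M. m f e = e}. \<forall>g\<in>{f \<in> M. m f e = e}. m f g \<in> {f \<in> M. m f e = e}"
      using M by (auto simp: assoc)
  qed blast
  then have "m e e = e" using e by blast
  then show ?thesis using e M by blast
qed

text \<open>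
  Let \<open>E\<close> be the pointwise closure of the acting semigroup. An idempotent \<open>e \<in> E\<close> sends \<open>x\<close> and \<open>e x\<close>
  to the same point, so distality gives \<open>e x = x\<close>. Applied to idempotents of the left ideals \<open>E p\<close>,
  this produces left inverses of all \<open>p \<in> E\<close>, and \<open>E\<close> is a group. The inverse of \<open>s\<close> lies in \<open>E\<close> only,
  so what survives for the semigroup itself is surjectivity of \<open>s\<close>, and approximate inversion of \<open>s\<close>
  at two points simultaneously.
\<close>
lemma
  fixes act :: "'s::semigroup_mult \<Rightarrow> 'b \<Rightarrow> 'b"
  assumes T: "compact_space T" "Hausdorff_space T" and dyn: "dynamical_system T act"
    and distal: "\<And>x y z. x \<in> topspace T \<Longrightarrow> y \<in> topspace T \<Longrightarrow> z \<in> topspace T \<Longrightarrow>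
      (\<And>W. openin T W \<Longrightarrow> z \<in> W \<Longrightarrow> \<exists>s. act s x \<in> W \<and> act s y \<in> W) \<Longrightarrow> x = y"
  shows distal_system_surjective: "act s ` topspace T = topspace T"
    and distal_system_recurrent:
      "\<And>x y V W. openin T V \<Longrightarrow> x \<in> V \<Longrightarrow> openin T W \<Longrightarrow> y \<in> W \<Longrightarrow>
        \<exists>t. act t (act s x) \<in> V \<and> act t (act s y) \<in> W"
proof -
  define K where "K = topspace T"
  have cont: "continuous_map T T (act s)" for s using dyn by (simp add: dynamical_system_def)
  have actK: "act s x \<in> K" if "x \<in> K" for s x
    using cont[of s] that by (auto simp: continuous_map_def K_def)
  have mult: "act (s * t) x = act s (act t x)" if "x \<in> K" for s t x
    using dyn that by (simp add: dynamical_system_def K_def)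
  have inv: "act s ` K = K \<and> (\<forall>x y V W. openin T V \<longrightarrow> x \<in> V \<longrightarrow> openin T W \<longrightarrow> y \<in> W \<longrightarrow>
        (\<exists>t. act t (act s x) \<in> V \<and> act t (act s y) \<in> W))" (is ?goal)
  proof (cases "K = {}")
    case True
    then show ?thesis using openin_subset by (fastforce simp: K_def)
  next
    case False
    then obtain k0 where k0: "k0 \<in> K" by blast
    \<comment> \<open>Precomposing with the retraction \<open>r\<close> onto the phase space makes all maps total with values in
      \<open>K\<close>, so that plain composition and a power of \<open>T\<close> indexed by the whole type can be used.\<close>
    define r where "r = (\<lambda>x. if x \<in> K then x else k0)"
    have rK: "r x \<in> K" for x using k0 by (simp add: r_def)
    have rid: "r x = x" if "x \<in> K" for x using that by (simp add: r_def)
    define P where "P = product_topology (\<lambda>_::'b. T) UNIV"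
    define F where "F = range (\<lambda>s. act s \<circ> r)"
    define E where "E = P closure_of F"
    have P: "compact_space P" "Hausdorff_space P"
      using T by (auto simp: P_def compact_space_product_topology Hausdorff_space_product_topology)
    have topP: "topspace P = {f. \<forall>x. f x \<in> K}" by (auto simp: P_def K_def)
    have proj: "continuous_map P T (\<lambda>f. f x)" for x
      unfolding P_def by (rule continuous_map_product_projection) simp
    have FP: "F \<subseteq> topspace P" using actK rK by (auto simp: F_def topP)
    have FE: "F \<subseteq> E" unfolding E_def by (rule closure_of_subset[OF FP])
    have Ecl: "closedin P E" by (simp add: E_def)
    have EK: "f x \<in> K" if "f \<in> E" for f x
      using that Ecl closedin_subset topP by blast
    have approx: "\<exists>s. act s (r x) \<in> V \<and> act s (r y) \<in> W"
      if "f \<in> E" "openin T V" "f x \<in> V" "openin T W" "f y \<in> W" for f x y V W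
    proof -
      let ?N = "{g \<in> topspace P. g x \<in> V} \<inter> {g \<in> topspace P. g y \<in> W}"
      have "openin P ?N"
        by (intro openin_Int openin_continuous_map_preimage[OF proj] that)
      moreover have "f \<in> ?N" using that EK by (auto simp: topP)
      moreover have "\<forall>N. f \<in> N \<and> openin P N \<longrightarrow> (\<exists>g\<in>F. g \<in> N)"
        using that(1) by (simp add: E_def in_closure_of Bex_def)
      ultimately have "\<exists>g\<in>F. g \<in> ?N" by meson
      then show ?thesis by (auto simp: F_def)
    qed
    have rightc: "continuous_map P P (\<lambda>f. f \<circ> g)" for g
      using proj by (simp add: P_def continuous_map_componentwise_UNIV comp_def)
    have rc: "continuous_map T T r"
      by (rule continuous_map_eq[OF continuous_map_id]) (simp add: r_def K_def)
    have leftc: "continuous_map P P (\<lambda>f. (act s \<circ> r) \<circ> f)" for s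
    proof -
      have "continuous_map P T ((act s \<circ> r) \<circ> (\<lambda>f. f x))" for x
        by (intro continuous_map_compose[OF proj] continuous_map_compose[OF rc] cont)
      then show ?thesis by (simp add: P_def continuous_map_componentwise_UNIV comp_def)
    qed
    have FF: "f \<circ> g \<in> F" if "f \<in> F" "g \<in> F" for f g
    proof -
      obtain s t where st: "f = act s \<circ> r" "g = act t \<circ> r" using \<open>f \<in> F\<close> \<open>g \<in> F\<close> by (auto simp: F_def)
      have "f \<circ> g = act (s * t) \<circ> r"
        using rK actK by (auto simp: st fun_eq_iff rid mult)
      then show ?thesis by (auto simp: F_def)
    qed
    \<comment> \<open>Left translations are continuous for members of \<open>F\<close> only, so the closure is passed to in
      the right factor first and in the left factor afterwards.\<close>
    have FE': "f \<circ> g \<in> E" if "f \<in> F" "g \<in> E" for f g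
    proof -
      obtain s where s: "f = act s \<circ> r" using \<open>f \<in> F\<close> by (auto simp: F_def)
      have "(\<lambda>h. f \<circ> h) ` E \<subseteq> P closure_of ((\<lambda>h. f \<circ> h) ` F)"
        unfolding E_def s by (rule continuous_map_image_closure_subset[OF leftc])
      also have "\<dots> \<subseteq> E" unfolding E_def using FF \<open>f \<in> F\<close> by (intro closure_of_mono) blast
      finally show ?thesis using \<open>g \<in> E\<close> by blast
    qed
    have EE: "f \<circ> g \<in> E" if "f \<in> E" "g \<in> E" for f g
    proof -
      have "(\<lambda>h. h \<circ> g) ` E \<subseteq> P closure_of ((\<lambda>h. h \<circ> g) ` F)"
        unfolding E_def by (rule continuous_map_image_closure_subset[OF rightc])
      also have "\<dots> \<subseteq> E" using FE' \<open>g \<in> E\<close> Ecl by (intro closure_of_minimal) blast+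
      finally show ?thesis using \<open>f \<in> E\<close> by blast
    qed
    have idem: "e x = x" if e: "e \<in> E" "e \<circ> e = e" and x: "x \<in> K" for e x
    proof (rule distal)
      show "e x \<in> topspace T" "x \<in> topspace T" "e x \<in> topspace T"
        using EK e x by (auto simp: K_def)
      fix W assume W: "openin T W" "e x \<in> W"
      have "e (e x) = e x" using e by (metis comp_apply)
      then show "\<exists>s. act s (e x) \<in> W \<and> act s x \<in> W"
        using approx[OF e(1) W(1) _ W(1), of "e x" x] W(2) rid x EK[OF e(1)] by simp
    qed
    have linv: "\<exists>q\<in>E. \<forall>x\<in>K. q (p x) = x" if p: "p \<in> E" for p
    proof -
      let ?L = "(\<lambda>f. f \<circ> p) ` E"
      have "compactin P ?L"
        using P Ecl by (intro image_compactin[OF _ rightc]) (auto intro: closedin_compact_space)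
      then have clL: "closedin P ?L" using P by (simp add: compactin_imp_closedin)
      have neL: "?L \<noteq> {}" using p by blast
      have "\<exists>e\<in>?L. e \<circ> e = e"
      proof (rule compact_right_topological_semigroup_idempotent[OF P clL neL, where m = "(\<circ>)"])
        fix f g assume "f \<in> ?L" "g \<in> ?L"
        then obtain f' g' where "f' \<in> E" "g' \<in> E" "f = f' \<circ> p" "g = g' \<circ> p" by blast
        then have "f \<circ> g = (f' \<circ> (p \<circ> g')) \<circ> p" "f' \<circ> (p \<circ> g') \<in> E"
          using EE p by (auto simp: comp_assoc)
        then show "f \<circ> g \<in> ?L" by blast
      qed (auto simp: comp_assoc rightc)
      then obtain q where q: "q \<in> E" "(q \<circ> p) \<circ> (q \<circ> p) = q \<circ> p" by blast
      have "(q \<circ> p) x = x" if "x \<in> K" for x using idem[OF EE[OF q(1) p] q(2) that] .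
      then show ?thesis using q by auto
    qed
    have sE: "act s \<circ> r \<in> E" using FE by (auto simp: F_def)
    \<comment> \<open>A left inverse \<open>q\<close> of \<open>s\<close> has a left inverse \<open>q'\<close> of its own; hence \<open>q\<close> inverts \<open>s\<close> on both
      sides.\<close>
    obtain q where q: "q \<in> E" "\<And>x. x \<in> K \<Longrightarrow> q (act s x) = x"
      using linv[OF sE] rid by force
    obtain q' where q': "\<And>x. x \<in> K \<Longrightarrow> q' (q x) = x"
      using linv[OF q(1)] by blast
    have "y \<in> act s ` K" if y: "y \<in> K" for y
    proof -
      have "act s (q y) = q' (q (act s (q y)))" using q' actK EK[OF q(1)] by simp
      also have "\<dots> = q' (q y)" using q(2) EK[OF q(1)] by simp
      also have "\<dots> = y" using q' y by simp
      finally show ?thesis using EK[OF q(1)] by (metis imageI)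
    qed
    then have "act s ` K = K" using actK by blast
    moreover have "\<exists>t. act t (act s x) \<in> V \<and> act t (act s y) \<in> W"
      if "openin T V" "x \<in> V" "openin T W" "y \<in> W" for x y V W
    proof -
      have xy: "x \<in> K" "y \<in> K" using that openin_subset by (auto simp: K_def)
      then show ?thesis
        using approx[OF q(1) that(1) _ that(3), of "act s x" "act s y"] q(2) that actK rid by simp
    qed
    ultimately show ?thesis by blast
  qed
  show "act s ` topspace T = topspace T" using inv by (simp add: K_def)
  show "\<exists>t. act t (act s x) \<in> V \<and> act t (act s y) \<in> W"
    if "openin T V" "x \<in> V" "openin T W" "y \<in> W" for x y V W
    using inv that by blast
qed

section \<open>Weak star compact sets in duals of Asplund spaces\<close>

text \<open>The uniform boundedness principle, by the Baire category theorem.\<close>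
lemma pointwise_bounded_imp_bounded:
  fixes K :: "('a::banach \<Rightarrow>\<^sub>L 'b::real_normed_vector) set"
  assumes pw: "\<And>x. bounded ((\<lambda>k. blinfun_apply k x) ` K)"
  shows "bounded K"
proof -
  define C where "C n = {x. \<forall>k\<in>K. norm (blinfun_apply k x) \<le> real n}" for n
  have clC: "closed (C n)" for n
  proof -
    have "C n = (\<Inter>k\<in>K. {x. norm (blinfun_apply k x) \<le> real n})" by (auto simp: C_def)
    also have "closed \<dots>"
      by (intro closed_INT ballI closed_Collect_le continuous_intros)
    finally show ?thesis .
  qed
  have "\<exists>n. interior (C n) \<noteq> {}"
  proof (rule ccontr)
    assume "\<not> ?thesis"
    then have "euclidean interior_of \<Union>(range C) = {}"
      by (intro Baire_category_alt) (auto simp: completely_metrizable_space_euclidean clC)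
    moreover have "\<Union>(range C) = UNIV"
    proof (intro equalityI subsetI UNIV_I)
      fix x
      obtain B where "\<forall>k\<in>K. norm (blinfun_apply k x) \<le> B"
        using pw[of x] by (auto simp: bounded_iff)
      moreover obtain n where "B \<le> real n" using real_arch_simple by blast
      ultimately have "x \<in> C n" unfolding C_def by (auto intro: order_trans)
      then show "x \<in> \<Union>(range C)" by blast
    qed
    ultimately show False by simp
  qed
  then obtain n a where "a \<in> interior (C n)" by blast
  then obtain e where e: "e > 0" "ball a e \<subseteq> C n" by (metis mem_interior)
  have "norm k \<le> (2 * real n) / (e / 2)" if k: "k \<in> K" for k
  proof (rule norm_blinfun_bound)
    show "0 \<le> (2 * real n) / (e / 2)" using e by simp
    fix x
    show "norm (blinfun_apply k x) \<le> (2 * real n) / (e / 2) * norm x"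
    proof (cases "x = 0")
      case False
      define c where "c = e / 2 / norm x"
      have c: "c > 0" using e False by (simp add: c_def)
      have "a + c *\<^sub>R x \<in> ball a e" using e False by (simp add: c_def dist_norm)
      then have "norm (blinfun_apply k (a + c *\<^sub>R x)) \<le> n" using e k by (auto simp: C_def)
      moreover have "norm (blinfun_apply k a) \<le> n"
        using e(2) k centre_in_ball[of a e] e(1) unfolding C_def by blast
      moreover have "c *\<^sub>R blinfun_apply k x = blinfun_apply k (a + c *\<^sub>R x) - blinfun_apply k a"
        by (simp add: blinfun.add_right blinfun.scaleR_right)
      ultimately have "norm (c *\<^sub>R blinfun_apply k x) \<le> 2 * real n"
        using norm_triangle_ineq4[of "blinfun_apply k (a + c *\<^sub>R x)" "blinfun_apply k a"] by simp
      then have "norm (blinfun_apply k x) \<le> 2 * real n / c" using c by (simp add: field_simps)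
      then show ?thesis by (simp add: c_def)
    qed simp
  qed
  then show ?thesis by (auto simp: bounded_iff)
qed

lemma openin_weak_star_evaluation:
  assumes "open V"
  shows "openin weak_star_topology {f. blinfun_apply f x \<in> V}"
  using openin_continuous_map_preimage[OF strong_operator_topology_continuous_evaluation, of V x] assms
  by (simp add: strong_operator_topology_topspace)

lemma closedin_weak_star_evaluation:
  assumes "closed V"
  shows "closedin weak_star_topology {f. blinfun_apply f x \<in> V}"
  using closedin_continuous_map_preimage[OF strong_operator_topology_continuous_evaluation, of V x] assms
  by (simp add: strong_operator_topology_topspace)

lemma Hausdorff_space_weak_star: "Hausdorff_space weak_star_topology"
proof (rule Hausdorff_space_injective_preimage)
  show "Hausdorff_space (euclidean :: ('a \<Rightarrow> real) topology)"
    unfolding euclidean_product_topology[symmetric] by (simp add: Hausdorff_space_product_topology)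
  show "continuous_map weak_star_topology euclidean (blinfun_apply :: _ \<Rightarrow> 'a \<Rightarrow> real)"
    using continuous_map_pullback[OF continuous_map_id, of UNIV blinfun_apply]
    by (simp add: strong_operator_topology_def)
qed (simp add: inj_on_def blinfun_apply_inject)

lemma norm_blinfun_le_iff:
  fixes f :: "'a::real_normed_vector \<Rightarrow>\<^sub>L 'b::real_normed_vector"
  assumes "0 \<le> r"
  shows "norm f \<le> r \<longleftrightarrow> (\<forall>x. norm (blinfun_apply f x) \<le> r * norm x)"
  using assms norm_blinfun_bound[of r f] norm_blinfun[of f]
  by (meson mult_right_mono norm_ge_zero order_trans)

text \<open>The dual norm is weak\<open>\<^sup>*\<close> lower semicontinuous, being a supremum of evaluations.\<close>
lemma closedin_weak_star_cball: "closedin weak_star_topology {f. norm (f - k) \<le> r}"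
proof (cases "0 \<le> r")
  case True
  have "{f. norm (f - k) \<le> r} =
      (\<Inter>x. {f. blinfun_apply f x \<in> cball (blinfun_apply k x) (r * norm x)})"
    by (auto simp: norm_blinfun_le_iff[OF True] blinfun.diff_left dist_norm abs_minus_commute)
  also have "closedin weak_star_topology \<dots>"
    by (intro closedin_INT closedin_weak_star_evaluation) auto
  finally show ?thesis .
next
  case False
  then have "{f. norm (f - k) \<le> r} = {}" by (auto simp: not_le intro: less_le_trans)
  then show ?thesis by simp
qed

lemma weak_star_compact_imp_bounded:
  fixes K :: "('a::banach \<Rightarrow>\<^sub>L real) set"
  assumes "compactin weak_star_topology K"
  shows "bounded K"
proof (rule pointwise_bounded_imp_bounded)
  fix x
  have "compactin euclidean ((\<lambda>k. blinfun_apply k x) ` K)"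
    by (rule image_compactin[OF assms strong_operator_topology_continuous_evaluation])
  then show "bounded ((\<lambda>k. blinfun_apply k x) ` K)" by (simp add: compact_imp_bounded)
qed

text \<open>
  Let \<open>p\<close> be the support functional of \<open>K\<close>, with Frechet derivative \<open>p'\<close> at \<open>a\<close>. If \<open>k \<in> K\<close> almost
  attains \<open>p a\<close>, then \<open>k (a + h) \<le> p (a + h)\<close> bounds \<open>(k - p') h\<close> by a small multiple of \<open>norm h\<close>,
  uniformly over all \<open>h\<close> of one fixed small norm. Therefore all such \<open>k\<close> are close to \<open>p'\<close>.
\<close>
lemma asplund_small_weak_star_slice:
  fixes K :: "('a::banach \<Rightarrow>\<^sub>L real) set"
  assumes asp: "asplund_space TYPE('a)" and bK: "bounded K" and ne: "K \<noteq> {}" and e: "e > 0"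
  obtains U where "openin weak_star_topology U" "U \<inter> K \<noteq> {}"
    "\<And>k l. k \<in> U \<inter> K \<Longrightarrow> l \<in> U \<inter> K \<Longrightarrow> norm (k - l) \<le> e"
proof -
  define p where "p x = (SUP k\<in>K. blinfun_apply k x)" for x
  obtain B where B: "\<And>k. k \<in> K \<Longrightarrow> norm k \<le> B" using bK by (auto simp: bounded_iff)
  have B0: "0 \<le> B" using ne B norm_ge_zero order_trans by blast
  have abs_le: "\<bar>blinfun_apply k x\<bar> \<le> B * norm x" if "k \<in> K" for k x
    using norm_blinfun[of k x] B[OF that] by (metis mult_right_mono norm_ge_zero order_trans real_norm_def)
  have le_p: "blinfun_apply k x \<le> p x" if "k \<in> K" for k x
    unfolding p_def
  proof (rule cSUP_upper[OF that])
    show "bdd_above ((\<lambda>k. blinfun_apply k x) ` K)"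
      using abs_le by (intro bdd_aboveI2[where M = "B * norm x"]) (fastforce simp: abs_le_iff)
  qed
  have p_le: "p x \<le> c" if "\<And>k. k \<in> K \<Longrightarrow> blinfun_apply k x \<le> c" for x c
    unfolding p_def by (rule cSUP_least[OF ne that])
  have conv: "convex_on UNIV p"
  proof (rule convex_onI)
    fix t x y assume t: "0 < t" "t < (1::real)"
    show "p ((1 - t) *\<^sub>R x + t *\<^sub>R y) \<le> (1 - t) * p x + t * p y"
    proof (rule p_le)
      fix k assume k: "k \<in> K"
      show "blinfun_apply k ((1 - t) *\<^sub>R x + t *\<^sub>R y) \<le> (1 - t) * p x + t * p y"
        using t le_p[OF k]
        by (simp add: blinfun.add_right blinfun.scaleR_right add_mono mult_left_mono)
    qed
  qed simp
  have half: "p x \<le> p y + B * norm (x - y)" for x y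
  proof (rule p_le)
    fix k assume k: "k \<in> K"
    have "blinfun_apply k x = blinfun_apply k y + blinfun_apply k (x - y)"
      by (simp add: blinfun.diff_right)
    then show "blinfun_apply k x \<le> p y + B * norm (x - y)"
      using le_p[OF k, of y] abs_le[OF k, of "x - y"] by linarith
  qed
  have "B-lipschitz_on UNIV p"
  proof (rule lipschitz_onI[OF _ B0])
    fix x y
    show "dist (p x) (p y) \<le> B * dist x y"
      using half[of x y] half[of y x] by (simp add: dist_norm norm_minus_commute abs_le_iff)
  qed
  then have cont: "continuous_on UNIV p" by (rule lipschitz_on_continuous_on)
  obtain G where G: "UNIV \<subseteq> closure G" "\<forall>x\<in>G. p differentiable (at x)"
    using asp conv cont unfolding asplund_space_def by (meson convex_UNIV open_UNIV)
  then obtain a where "p differentiable (at a)" by (metis UNIV_not_empty closure_empty equals0I subset_empty)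
  then obtain p' where p': "(p has_derivative p') (at a)" by (auto simp: differentiable_def)
  \<comment> \<open>An error \<open>c\<close> from differentiability and an error \<open>c\<close> from the slice place each functional within
    \<open>2 * c\<close> of \<open>p'\<close>, so two of them are within \<open>4 * c\<close>.\<close>
  define c where "c = e / 4"
  have c: "c > 0" using e by (simp add: c_def)
  have lin: "linear p'" using p' by (intro bounded_linear.linear has_derivative_bounded_linear)
  obtain d where d: "d > 0" "\<And>y. norm (y - a) < d \<Longrightarrow> norm (p y - p a - p' (y - a)) \<le> c * norm (y - a)"
    using p' c unfolding has_derivative_at_alt by meson
  define \<eta> where "\<eta> = d / 2"
  have \<eta>: "0 < \<eta>" "\<eta> < d" using d by (auto simp: \<eta>_def)
  define U where "U = {f :: 'a \<Rightarrow>\<^sub>L real. blinfun_apply f a \<in> {p a - c * \<eta> <..}}"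
  have bound: "blinfun_apply k h - p' h \<le> 2 * c * \<eta>" if k: "k \<in> U \<inter> K" and h: "norm h = \<eta>" for k h
  proof -
    have "blinfun_apply k a + blinfun_apply k h \<le> p (a + h)"
      using le_p[of k "a + h"] k by (simp add: blinfun.add_right)
    moreover have "p (a + h) - p a - p' h \<le> c * \<eta>"
      using d(2)[of "a + h"] h \<eta> by simp
    moreover have "blinfun_apply k a > p a - c * \<eta>" using k by (simp add: U_def)
    ultimately show ?thesis by linarith
  qed
  show thesis
  proof
    show "openin weak_star_topology U"
      unfolding U_def by (rule openin_weak_star_evaluation) simp
    show "U \<inter> K \<noteq> {}"
    proof
      assume "U \<inter> K = {}"
      then have "p a \<le> p a - c * \<eta>" by (intro p_le) (force simp: U_def not_less[symmetric])
      moreover have "c * \<eta> > 0" using c \<eta> by simp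
      ultimately show False by simp
    qed
    fix k l assume k: "k \<in> U \<inter> K" and l: "l \<in> U \<inter> K"
    have diff: "blinfun_apply (k - l) h \<le> e * \<eta>" if h: "norm h = \<eta>" for h
    proof -
      have "p' (- h) = - p' h" using lin by (rule linear_neg)
      then show ?thesis
        using bound[OF k h] bound[OF l, of "- h"] h
        by (simp add: blinfun.diff_left blinfun.minus_right c_def)
    qed
    show "norm (k - l) \<le> e"
    proof (rule norm_blinfun_bound)
      show "0 \<le> e" using e by simp
      fix x
      show "norm (blinfun_apply (k - l) x) \<le> e * norm x"
      proof (cases "x = 0")
        case False
        define t where "t = \<eta> / norm x"
        have t: "t > 0" "norm (t *\<^sub>R x) = \<eta>" "norm (- (t *\<^sub>R x)) = \<eta>"
          using \<eta> False by (auto simp: t_def)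
        have "t * \<bar>blinfun_apply (k - l) x\<bar> \<le> e * \<eta>"
          using diff[OF t(2)] diff[OF t(3)] t(1)
          by (cases "0 \<le> blinfun_apply (k - l) x")
            (simp_all add: blinfun.scaleR_right blinfun.minus_right)
        also have "e * \<eta> = t * (e * norm x)" using False by (simp add: t_def)
        finally show ?thesis using t(1) by simp
      qed simp
    qed
  qed
qed

section \<open>The fixed point\<close>

text \<open>
  A set with a finite \<open>d / 2\<close>-net, \<open>d\<close> being its diameter, has a point in its convex hull from which
  it looks smaller than \<open>d\<close>: in the average of the distances from \<open>k\<close> to the points of the net, at
  least one term is at most \<open>d / 2\<close> while the others are at most \<open>d\<close>.
\<close>
lemma average_closer_than_diameter:
  fixes K :: "'v::real_normed_vector set"
  assumes K: "bounded K" "0 < diameter K" and A: "finite A" "A \<noteq> {}" "A \<subseteq> K"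
    and net: "\<And>k. k \<in> K \<Longrightarrow> \<exists>a\<in>A. norm (a - k) \<le> diameter K / 2"
  obtains u r where "u \<in> convex hull A" "r < diameter K" "\<And>k. k \<in> K \<Longrightarrow> norm (u - k) \<le> r"
proof -
  define n where "n = real (card A)"
  define d where "d = diameter K"
  define u where "u = (\<Sum>a\<in>A. (1 / n) *\<^sub>R a)"
  have n: "n > 0" using A by (simp add: n_def card_gt_0_iff)
  have d: "d > 0" using K by (simp add: d_def)
  show thesis
  proof
    show "u \<in> convex hull A"
      unfolding u_def using A n by (intro convex_sum) (auto simp: n_def hull_inc)
    show "d - d / (2 * n) < diameter K" using n d by (simp add: d_def)
    fix k assume k: "k \<in> K"
    then obtain b where b: "b \<in> A" "norm (b - k) \<le> d / 2" using net by (auto simp: d_def)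
    have "u - k = (\<Sum>a\<in>A. (1 / n) *\<^sub>R (a - k))"
      using n by (simp add: u_def scaleR_diff_right sum_subtractf sum_constant_scaleR n_def)
    also have "norm \<dots> \<le> (\<Sum>a\<in>A. (1 / n) * norm (a - k))"
      using n by (intro sum_norm_le) simp
    also have "\<dots> = (1 / n) * (norm (b - k) + (\<Sum>a\<in>A - {b}. norm (a - k)))"
      using A b by (simp only: sum_distrib_left[symmetric] sum.remove)
    also have "\<dots> \<le> (1 / n) * (d / 2 + (\<Sum>a\<in>A - {b}. d))"
    proof (intro mult_left_mono add_mono sum_mono)
      fix a assume "a \<in> A - {b}"
      then show "norm (a - k) \<le> d"
        using diameter_bounded_bound[OF K(1), of a k] A k by (auto simp: d_def dist_norm)
    qed (use b n in auto)
    also have "(\<Sum>a\<in>A - {b}. d) = (n - 1) * d"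
      using A b by (simp add: n_def card_Diff_singleton of_nat_diff card_gt_0_iff Suc_leI)
    also have "(1 / n) * (d / 2 + (n - 1) * d) = d - d / (2 * n)" using n by (simp add: field_simps)
    finally show "norm (u - k) \<le> d - d / (2 * n)" .
  qed
qed

theorem corollary3p2:
  fixes Q :: "('a::banach \<Rightarrow>\<^sub>L real) set"
    and act :: "'s::semigroup_mult \<Rightarrow> ('a \<Rightarrow>\<^sub>L real) \<Rightarrow> ('a \<Rightarrow>\<^sub>L real)"
  assumes "asplund_space TYPE('a)"
    and "Q \<noteq> {}"
    and "compactin weak_star_topology Q"
    and "convex Q"
    and "dynamical_system (subtopology weak_star_topology Q) act"
    and "nonexpansive_action Q act"
    and "norm_distal Q act"
  shows "\<exists>x\<in>Q. \<forall>s. act s x = x"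
proof -
  define T where "T = subtopology weak_star_topology Q"
  have topT: "topspace T = Q" by (simp add: T_def strong_operator_topology_topspace)
  have closedQ: "closedin T Q" using closedin_topspace[of T] by (simp add: topT)
  have dynT: "dynamical_system T act" using assms(5) by (simp add: T_def)
  have T: "compact_space T"
    using assms(3) by (simp add: T_def compact_space_subtopology)
  have nonexp: "norm (act s x - act s y) \<le> norm (x - y)" if "x \<in> Q" "y \<in> Q" for s x y
    using assms(6) that by (simp add: nonexpansive_action_def)
  have actQ: "act s ` Q \<subseteq> Q" for s
    using dynT topT by (auto simp: dynamical_system_def continuous_map_def)

  obtain C where C: "C \<subseteq> Q" "closedin T C" "C \<noteq> {}" "convex C \<and> (\<forall>s. act s ` C \<subseteq> C)"
    and minC: "\<And>D. D \<subseteq> C \<Longrightarrow> closedin T D \<Longrightarrow> D \<noteq> {} \<Longrightarrow> convex D \<and> (\<forall>s. act s ` D \<subseteq> D) \<Longrightarrow> D = C"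
  proof (rule minimal_closed_subset[OF T, where C = Q and P = "\<lambda>D. convex D \<and> (\<forall>s. act s ` D \<subseteq> D)"])
    show "closedin T Q" by (rule closedQ)
    show "convex Q \<and> (\<forall>s. act s ` Q \<subseteq> Q)" using assms(4) actQ by blast
    fix \<C> assume "\<And>A. A \<in> \<C> \<Longrightarrow> convex A \<and> (\<forall>s. act s ` A \<subseteq> A)"
    then show "convex (\<Inter>\<C>) \<and> (\<forall>s. act s ` \<Inter>\<C> \<subseteq> \<Inter>\<C>)"
      by (intro conjI convex_Inter) blast+
  qed (use assms(2) in \<open>auto intro: that\<close>)
  obtain K where K: "K \<subseteq> C" "closedin T K" "K \<noteq> {}" "\<forall>s. act s ` K \<subseteq> K"
    and minK: "\<And>D. D \<subseteq> K \<Longrightarrow> closedin T D \<Longrightarrow> D \<noteq> {} \<Longrightarrow> \<forall>s. act s ` D \<subseteq> D \<Longrightarrow> D = K"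
  proof (rule minimal_closed_subset[OF T, where C = C and P = "\<lambda>D. \<forall>s. act s ` D \<subseteq> D"])
    fix \<C> assume "\<And>A. A \<in> \<C> \<Longrightarrow> \<forall>s. act s ` A \<subseteq> A"
    then show "\<forall>s. act s ` \<Inter>\<C> \<subseteq> \<Inter>\<C>" by blast
  qed (use C in \<open>auto intro: that\<close>)
  have KQ: "K \<subseteq> Q" using K C by blast
  have act_mult: "act (s * t) x = act s (act t x)" if "x \<in> K" for s t x
    using dynT that KQ topT by (auto simp: dynamical_system_def)
  have visit: "\<exists>s. act s x \<in> U" if "x \<in> K" "openin weak_star_topology U" "U \<inter> K \<noteq> {}" for x U
  proof -
    have "\<exists>s. act s x \<in> Q \<inter> U"
    proof (rule orbit_meets_open_of_minimal[OF dynT K(2)])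
      show "openin T (Q \<inter> U)" unfolding T_def using that by (simp add: openin_subtopology_Int2)
    qed (use K minK KQ that in blast)+
    then show ?thesis by blast
  qed

  define S where "S = subtopology weak_star_topology K"
  have topS: "topspace S = K" by (simp add: S_def strong_operator_topology_topspace)
  have ST: "S = subtopology T K"
    using KQ by (simp add: S_def T_def subtopology_subtopology Int_absorb1)
  have S: "compact_space S" "Hausdorff_space S"
    using closedin_compact_space[OF T K(2)]
    by (simp_all add: ST T_def compact_space_subtopology Hausdorff_space_subtopology Hausdorff_space_weak_star)
  have bK: "bounded K"
    using weak_star_compact_imp_bounded[OF assms(3)] KQ bounded_subset by blast
  have dynS: "dynamical_system S act"
    unfolding dynamical_system_def
  proof (intro conjI allI ballI)
    fix s
    have "continuous_map T T (act s)" using dynT by (simp add: dynamical_system_def)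
    then show "continuous_map S S (act s)"
      using K(4) unfolding ST
      by (intro continuous_map_into_subtopology continuous_map_from_subtopology) auto
  qed (simp add: topS act_mult)
  \<comment> \<open>A weak\<open>\<^sup>*\<close> proximal pair is norm proximal: push the common limit \<open>z\<close> into a slice of small norm
    diameter; weak\<open>\<^sup>*\<close> continuity carries the pair along.\<close>
  have distalS: "x = y"
    if xyz: "x \<in> topspace S" "y \<in> topspace S" "z \<in> topspace S"
      and prox: "\<And>W. openin S W \<Longrightarrow> z \<in> W \<Longrightarrow> \<exists>s. act s x \<in> W \<and> act s y \<in> W" for x y z
  proof (rule ccontr)
    assume "x \<noteq> y"
    have "0 \<in> closure (range (\<lambda>s. act s x - act s y))"
      unfolding closure_approachable
    proof (intro allI impI)
      fix e :: real assume "e > 0"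
      then obtain U where U: "openin weak_star_topology U" "U \<inter> K \<noteq> {}"
        "\<And>k l. k \<in> U \<inter> K \<Longrightarrow> l \<in> U \<inter> K \<Longrightarrow> norm (k - l) \<le> e / 2"
        using asplund_small_weak_star_slice[OF assms(1) bK K(3), of "e / 2"] by (metis half_gt_zero)
      obtain t where t: "act t z \<in> U" using visit[OF _ U(1,2)] xyz topS by blast
      have "openin S (K \<inter> U)" unfolding S_def using U by (simp add: openin_subtopology_Int2)
      then have "openin S {w \<in> topspace S. act t w \<in> K \<inter> U}"
        using dynS by (intro openin_continuous_map_preimage) (auto simp: dynamical_system_def)
      moreover have "z \<in> {w \<in> topspace S. act t w \<in> K \<inter> U}" using t xyz K topS by blast
      ultimately obtain s where s: "act t (act s x) \<in> K \<inter> U" "act t (act s y) \<in> K \<inter> U"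
        using prox by blast
      then have "norm (act (t * s) x - act (t * s) y) \<le> e / 2"
        using U(3) xyz topS act_mult by simp
      then show "\<exists>v\<in>range (\<lambda>s. act s x - act s y). dist v 0 < e"
        using \<open>e > 0\<close> by (intro bexI[where x = "act (t * s) x - act (t * s) y"]) auto
    qed
    then show False
      using assms(7) \<open>x \<noteq> y\<close> xyz topS KQ unfolding norm_distal_def by blast
  qed
  have "act s ` topspace S = topspace S" for s
    by (rule distal_system_surjective[OF S dynS]) (fact distalS)
  then have surj: "act s ` K = K" for s by (simp add: topS)
  \<comment> \<open>Return \<open>s x\<close> and \<open>s y\<close> approximately to \<open>x\<close> and \<open>y\<close> by some \<open>t\<close>; this does not increase their
    distance, and the norm is determined by evaluations.\<close>
  have isometry: "norm (x - y) \<le> norm (act s x - act s y)" if "x \<in> K" "y \<in> K" for s x y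
  proof (rule iffD2[OF norm_blinfun_le_iff[OF norm_ge_zero]], rule allI, rule field_le_epsilon)
    fix h and e :: real assume e: "e > 0"
    define N where "N w = K \<inter> {f. blinfun_apply f h \<in> ball (blinfun_apply w h) (e / 2)}" for w
    have N: "openin S (N w)" for w
      unfolding S_def N_def by (intro openin_subtopology_Int2 openin_weak_star_evaluation) simp
    have "\<exists>t. act t (act s x) \<in> N x \<and> act t (act s y) \<in> N y"
    proof (rule distal_system_recurrent[OF S dynS _ N _ N])
      show "x \<in> N x" "y \<in> N y" using that e by (auto simp: N_def)
    qed (fact distalS)
    then obtain t where t: "act t (act s x) \<in> N x" "act t (act s y) \<in> N y" by blast
    have "norm (act t (act s x) - act t (act s y)) \<le> norm (act s x - act s y)"
      using that K KQ by (intro nonexp) blast+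
    then have "\<bar>blinfun_apply (act t (act s x) - act t (act s y)) h\<bar> \<le> norm (act s x - act s y) * norm h"
      using norm_blinfun_le_iff[OF norm_ge_zero] by (metis real_norm_def)
    then show "norm (blinfun_apply (x - y) h) \<le> norm (act s x - act s y) * norm h + e"
      using t by (simp add: N_def blinfun.diff_left dist_real_def abs_if split: if_splits)
  qed

  have "diameter K = 0"
  proof (rule ccontr)
    assume "diameter K \<noteq> 0"
    then have d: "diameter K > 0" using diameter_ge_0[OF bK] by simp
    then obtain U where U: "openin weak_star_topology U" "U \<inter> K \<noteq> {}"
      "\<And>k l. k \<in> U \<inter> K \<Longrightarrow> l \<in> U \<inter> K \<Longrightarrow> norm (k - l) \<le> diameter K / 2"
      using asplund_small_weak_star_slice[OF assms(1) bK K(3), of "diameter K / 2"] by (metis half_gt_zero)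
    define V where "V s = {x \<in> K. act s x \<in> U}" for s
    have "openin S (V s)" for s
    proof -
      have "openin S (K \<inter> U)" unfolding S_def using U by (simp add: openin_subtopology_Int2)
      then have "openin S {w \<in> topspace S. act s w \<in> K \<inter> U}"
        using dynS by (intro openin_continuous_map_preimage) (auto simp: dynamical_system_def)
      also have "{w \<in> topspace S. act s w \<in> K \<inter> U} = V s" using K by (auto simp: V_def topS)
      finally show ?thesis .
    qed
    moreover have "topspace S \<subseteq> \<Union>(range V)"
      using visit[OF _ U(1,2)] by (auto simp: topS V_def)
    ultimately have "\<exists>\<F>. finite \<F> \<and> \<F> \<subseteq> range V \<and> topspace S \<subseteq> \<Union>\<F>"
      using S(1)[unfolded compact_space_alt, rule_format, of "range V"] by auto
    then obtain \<F> where \<F>: "finite \<F>" "\<F> \<subseteq> range V" "K \<subseteq> \<Union>\<F>"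
      unfolding topS by blast
    \<comment> \<open>One point from each nonempty piece: the pieces have diameter at most half that of \<open>K\<close>
      because their images under an isometry lie in \<open>U\<close>.\<close>
    define A where "A = (\<lambda>B. SOME a. a \<in> B) ` (\<F> - {{}})"
    have A: "finite A" using \<F> by (simp add: A_def)
    have in_piece: "(SOME a. a \<in> B) \<in> B" if "B \<noteq> {}" for B :: "('a \<Rightarrow>\<^sub>L real) set"
      using that by (simp add: some_in_eq)
    have AK: "A \<subseteq> K"
    proof
      fix a assume "a \<in> A"
      then obtain B where "B \<in> \<F>" "a \<in> B" using in_piece unfolding A_def by blast
      then show "a \<in> K" using \<F>(2) by (auto simp: V_def)
    qed
    have net: "\<exists>a\<in>A. norm (a - k) \<le> diameter K / 2" if k: "k \<in> K" for k
    proof -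
      obtain B where B: "B \<in> \<F>" "k \<in> B" using \<F>(3) k by blast
      then obtain s where "B = V s" using \<F>(2) by blast
      then have s: "V s \<in> \<F>" "k \<in> V s" using B by auto
      define a where "a = (SOME a. a \<in> V s)"
      have a: "a \<in> V s" using in_piece s unfolding a_def by blast
      have "norm (a - k) \<le> norm (act s a - act s k)"
        using a s by (intro isometry) (auto simp: V_def)
      also have "\<dots> \<le> diameter K / 2"
        using a s K by (intro U(3)) (auto simp: V_def)
      finally show ?thesis using s by (auto simp: A_def a_def)
    qed
    then have "A \<noteq> {}" using K by blast
    then obtain u r where u: "u \<in> convex hull A" and r: "r < diameter K"
      and ur: "\<And>k. k \<in> K \<Longrightarrow> norm (u - k) \<le> r"
      using average_closer_than_diameter[OF bK d A _ AK net] by blast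
    define D where "D = C \<inter> (\<Inter>k\<in>K. {x. norm (x - k) \<le> r})"
    have "D = C"
    proof (rule minC)
      show "D \<subseteq> C" by (simp add: D_def)
      have "closedin T (Q \<inter> (\<Inter>k\<in>K. {x. norm (x - k) \<le> r}))"
        using K(3) closedQ unfolding T_def
        by (intro closedin_subtopology_Int_closedin closedin_INT closedin_weak_star_cball)
      moreover have "D = C \<inter> (Q \<inter> (\<Inter>k\<in>K. {x. norm (x - k) \<le> r}))" using C by (auto simp: D_def)
      ultimately show "closedin T D" using C(2) by auto
      have "u \<in> C" using u AK K(1) C(4) hull_minimal[of A C convex] by blast
      then show "D \<noteq> {}" using ur by (auto simp: D_def)
      have "{x. norm (x - k) \<le> r} = cball k r" for k :: "'a \<Rightarrow>\<^sub>L real"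
        by (auto simp: dist_norm norm_minus_commute)
      then have "convex D"
        unfolding D_def using C by (intro convex_Int convex_INT) auto
      moreover have "act s x \<in> D" if x: "x \<in> D" for s x
      proof -
        have "norm (act s x - k) \<le> r" if k: "k \<in> K" for k
        proof -
          obtain l where l: "l \<in> K" "k = act s l" using surj k by blast
          have "norm (act s x - act s l) \<le> norm (x - l)"
            using x l C KQ by (intro nonexp) (auto simp: D_def)
          also have "\<dots> \<le> r" using x l by (simp add: D_def)
          finally show ?thesis using l by simp
        qed
        moreover have "act s x \<in> C" using x C(4) unfolding D_def by blast
        ultimately show ?thesis by (simp add: D_def)
      qed
      ultimately show "convex D \<and> (\<forall>s. act s ` D \<subseteq> D)" by blast
    qed
    then have "diameter K \<le> r"
      using K by (intro diameter_le) (auto simp: D_def)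
    then show False using r by simp
  qed
  then have single: "x = y" if "x \<in> K" "y \<in> K" for x y
    using diameter_bounded_bound[OF bK that] by simp
  obtain x where x: "x \<in> K" using K by blast
  then have "act s x = x" for s using single K by blast
  then show ?thesis using x KQ by blast
qed

end
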